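(* Let $G=(V,E)$ be a directed acyclic graph and $s,t\in V$. Let $S$ be a minimum-cardinality identifying set for $X^{\mathrm{path}}_{G,s,t}$ and let $S'$ be a minimum-cardinality identifying set for $X^{\mathrm{flow}}_{G,s,t}$. Then $|S'| \le \frac{(|S|+1)|S|}{2}$. Moreover, for every $k\in\mathbb{N}$ there is such an instance (a directed acyclic graph with nodes $s,t$) in which $|S|=k$ and $|S'| = \frac{(|S|+1)|S|}{2}$.
   Context: $X^{\mathrm{path}}_{G,s,t} := \{\chi_P : P \text{ is an } s\text{-}t\text{-path in } G\}\subseteq\{0,1\}^E$, with $\chi_P$ the incidence vector of the arc set of $P$. $X^{\mathrm{flow}}_{G,s,t}$ is the set of all $s$-$t$-flows of value $1$ in $G$, i.e., all $x\in\mathbb{R}_+^E$ satisfying flow conservation at all nodes other than $s,t$, with net outflow $1$ at $s$ and net inflow $1$ at $t$. A set $S \subseteq E$ is identifying for $X$ if for all $x, x' \in X$ with $x \neq x'$ there is $e \in S$ with $x_e \neq x'_e$. *)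

theory Defs
  imports Complex_Main "HOL-Library.FuncSet" "Graph_Theory.Digraph" "Graph_Theory.Arc_Walk"
begin

text \<open>
  Vectors indexed by the arc set \<open>E\<close> are extensional functions on \<open>E\<close>, so that equality of
  functions is equality of vectors.
\<close>

text \<open>Parallel arcs are allowed; loops are cycles and hence excluded.\<close>

definition acyclic_digraph :: "('a, 'b) pre_digraph \<Rightarrow> bool" where
  "acyclic_digraph G \<longleftrightarrow> fin_digraph G \<and> (\<nexists>p. pre_digraph.cycle G p)"

definition incidence_vector :: "'b set \<Rightarrow> 'b set \<Rightarrow> 'b \<Rightarrow> real" where
  "incidence_vector E P = (\<lambda>e\<in>E. if e \<in> P then 1 else 0)"

definition path_vectors :: "('a, 'b) pre_digraph \<Rightarrow> 'a \<Rightarrow> 'a \<Rightarrow> ('b \<Rightarrow> real) set" where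
  "path_vectors G s t = {incidence_vector (arcs G) (set p) | p. pre_digraph.apath G s p t}"

definition net_outflow :: "('a, 'b) pre_digraph \<Rightarrow> ('b \<Rightarrow> real) \<Rightarrow> 'a \<Rightarrow> real" where
  "net_outflow G x v = (\<Sum>e\<in>out_arcs G v. x e) - (\<Sum>e\<in>in_arcs G v. x e)"

definition unit_flows :: "('a, 'b) pre_digraph \<Rightarrow> 'a \<Rightarrow> 'a \<Rightarrow> ('b \<Rightarrow> real) set" where
  "unit_flows G s t =
     {x \<in> arcs G \<rightarrow>\<^sub>E {0..}.
        (\<forall>v \<in> verts G - {s, t}. net_outflow G x v = 0) \<and>
        net_outflow G x s = 1 \<and> - net_outflow G x t = 1}"

definition identifying :: "'b set \<Rightarrow> ('b \<Rightarrow> real) set \<Rightarrow> 'b set \<Rightarrow> bool" where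
  "identifying E X S \<longleftrightarrow>
     S \<subseteq> E \<and> (\<forall>x\<in>X. \<forall>x'\<in>X. x \<noteq> x' \<longrightarrow> (\<exists>e\<in>S. x e \<noteq> x' e))"

definition min_identifying :: "'b set \<Rightarrow> ('b \<Rightarrow> real) set \<Rightarrow> 'b set \<Rightarrow> bool" where
  "min_identifying E X S \<longleftrightarrow>
     identifying E X S \<and> (\<forall>T. identifying E X T \<longrightarrow> card S \<le> card T)"

end

theory Submission
  imports Defs
begin

text \<open>
  Upper bound: a unit flow on an acyclic digraph is an affine combination of \<open>s\<close>-\<open>t\<close>-paths. If
  \<open>S\<close> identifies paths, then between two consecutive arcs of \<open>S\<close> on a path the route is unique, so
  a path is the image of a path in the complete acyclic digraph on \<open>S\<close> together with \<open>s\<close> and \<open>t\<close>,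
  whose unit flows have affine dimension \<open>k (k + 1) / 2\<close> for \<open>k = card S\<close>. The flows of the given
  digraph thus lie in an affine space of at most this dimension, and as many suitably chosen
  coordinates determine a point of it.

  Tightness: split every inner vertex of that complete acyclic digraph into an arc. The split arcs
  identify paths, and a flow-identifying set needs \<open>k (k + 1) / 2\<close> arcs because a positive flow can
  be perturbed by any circulation. By the upper bound, fewer than \<open>k\<close> arcs cannot identify paths.
\<close>

section \<open>Linear systems and counting\<close>

text \<open>Gaussian elimination: the combinations form a space of dimension at most
  \<open>card I\<close>, so at most that many coordinates detect a nonzero one. It will be applied
  to differences of flows.\<close>

lemma coordinates_separating_span:
  fixes w :: "'i \<Rightarrow> 'b \<Rightarrow> real"
  assumes "finite I"
  shows "\<exists>S\<subseteq>E. finite S \<and> card S \<le> card I \<and>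
    (\<forall>z. (\<forall>e\<in>S. (\<Sum>i\<in>I. z i * w i e) = 0) \<longrightarrow> (\<forall>e\<in>E. (\<Sum>i\<in>I. z i * w i e) = 0))"
  using assms
proof (induction I arbitrary: w rule: finite_induct)
  case empty
  show ?case by (rule exI[of _ "{}"]) simp
next
  case (insert p I)
  show ?case
  proof (cases "\<forall>e\<in>E. w p e = 0")
    case True
    obtain S where S: "S \<subseteq> E" "finite S" "card S \<le> card I"
      "\<And>z. \<forall>e\<in>S. (\<Sum>i\<in>I. z i * w i e) = 0 \<Longrightarrow> \<forall>e\<in>E. (\<Sum>i\<in>I. z i * w i e) = 0"
      using insert.IH[of w] by blast
    have eq: "(\<Sum>i\<in>insert p I. z i * w i e) = (\<Sum>i\<in>I. z i * w i e)" if "e \<in> E" for z e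
      using insert.hyps that True by simp
    have "\<forall>e\<in>E. (\<Sum>i\<in>insert p I. z i * w i e) = 0"
      if "\<forall>e\<in>S. (\<Sum>i\<in>insert p I. z i * w i e) = 0" for z
      using S(4)[of z] that eq S(1) by (simp add: subset_iff)
    with S(1-3) insert.hyps show ?thesis by (intro exI[of _ S]) auto
  next
    case False
    then obtain a where a: "a \<in> E" "w p a \<noteq> 0" by blast
    \<comment> \<open>Pivoting on \<open>w p a\<close> clears coordinate \<open>a\<close> from every
      other vector.\<close>
    define w' where "w' i e = w i e - w i a / w p a * w p e" for i e
    obtain S where S: "S \<subseteq> E" "finite S" "card S \<le> card I"
      "\<And>z. \<forall>e\<in>S. (\<Sum>i\<in>I. z i * w' i e) = 0 \<Longrightarrow> \<forall>e\<in>E. (\<Sum>i\<in>I. z i * w' i e) = 0"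
      using insert.IH[of w'] by blast
    have "\<forall>e\<in>E. (\<Sum>i\<in>insert p I. z i * w i e) = 0"
      if z: "\<forall>e\<in>insert a S. (\<Sum>i\<in>insert p I. z i * w i e) = 0" for z
    proof -
      have "z p * w p a + (\<Sum>i\<in>I. z i * w i a) = 0"
        using z insert.hyps by simp
      then have zp: "z p = - (\<Sum>i\<in>I. z i * w i a) / w p a"
        using a(2) by (simp add: field_simps)
      \<comment> \<open>Vanishing at \<open>a\<close> fixes \<open>z p\<close>; substituting it
        turns the combination into one of the reduced vectors.\<close>
      have eq: "(\<Sum>i\<in>insert p I. z i * w i e) = (\<Sum>i\<in>I. z i * w' i e)" for e
        using insert.hyps
        by (simp add: zp w'_def algebra_simps sum_subtractf sum_distrib_left sum_distrib_right sum_divide_distrib)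
      show ?thesis using S(4)[of z] z by (simp add: eq)
    qed
    moreover have "card (insert a S) \<le> card (insert p I)"
      using S(2,3) insert.hyps by (simp add: card_insert_if)
    moreover have "insert a S \<subseteq> E" "finite (insert a S)" using S(1,2) a(1) by auto
    ultimately show ?thesis by (intro exI[of _ "insert a S"] conjI allI impI)
  qed
qed

text \<open>\<open>C\<close> indexes the equations and \<open>E\<close> the unknowns; solving one
  equation for an unknown with nonzero coefficient eliminates both. This supplies a circulation that
  vanishes on a given arc set.\<close>

lemma underdetermined_system_nontrivial_solution:
  fixes a :: "'c \<Rightarrow> 'b \<Rightarrow> real"
  assumes "finite C" "finite E" "card C < card E"
  shows "\<exists>d. (\<exists>e\<in>E. d e \<noteq> 0) \<and> (\<forall>c\<in>C. (\<Sum>e\<in>E. a c e * d e) = 0)"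
  using assms
proof (induction C arbitrary: E a rule: finite_induct)
  case empty
  then obtain e where "e \<in> E" by (metis card.empty equals0I less_irrefl)
  then show ?case by (intro exI[of _ "\<lambda>_. 1"]) auto
next
  case (insert c C)
  show ?case
  proof (cases "\<forall>e\<in>E. a c e = 0")
    case True
    then show ?thesis using insert.IH[of E a] insert.prems insert.hyps by auto
  next
    case False
    then obtain f where f: "f \<in> E" "a c f \<noteq> 0" by blast
    define a' where "a' b e = a b e - a b f * a c e / a c f" for b e
    have "card C < card (E - {f})" using insert.prems insert.hyps f by simp
    then obtain d where d: "\<exists>e\<in>E - {f}. d e \<noteq> 0" "\<forall>b\<in>C. (\<Sum>e\<in>E - {f}. a' b e * d e) = 0"
      using insert.IH[of "E - {f}" a'] insert.prems by blast
    \<comment> \<open>The value at \<open>f\<close> is chosen to satisfy equation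
      \<open>c\<close>.\<close>
    define d' where "d' = d(f := - (\<Sum>e\<in>E - {f}. a c e * d e) / a c f)"
    have split: "(\<Sum>e\<in>E. a b e * d' e) =
        a b f * (- (\<Sum>e\<in>E - {f}. a c e * d e) / a c f) + (\<Sum>e\<in>E - {f}. a b e * d e)" for b
      using insert.prems(1) f(1) by (subst sum.remove[of _ f]) (auto simp: d'_def intro!: sum.cong)
    have "(\<Sum>e\<in>E. a b e * d' e) = (\<Sum>e\<in>E - {f}. a' b e * d e)" for b
      unfolding split
      by (simp add: a'_def algebra_simps sum_subtractf sum_distrib_left sum_divide_distrib)
    with d(2) have "\<forall>b\<in>C. (\<Sum>e\<in>E. a b e * d' e) = 0" by simp
    moreover have "(\<Sum>e\<in>E. a c e * d' e) = 0" using f(2) by (simp add: split)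
    moreover have "\<exists>e\<in>E. d' e \<noteq> 0" using d(1) by (auto simp: d'_def)
    ultimately show ?thesis by (intro exI[of _ d']) auto
  qed
qed

text \<open>\<open>R\<close>, its converse and the diagonal are pairwise disjoint subsets of
  \<open>S \<times> S\<close>. For reachability between the \<open>k\<close> arcs of an identifying
  set this gives the term \<open>k (k - 1) / 2\<close>.\<close>

lemma card_asymmetric_relation:
  assumes "finite S" "R \<subseteq> S \<times> S" "asym R"
  shows "2 * card R + card S \<le> card S * card S"
proof -
  have fin: "finite R" using assms finite_subset by blast
  have "card (R \<union> R\<inverse> \<union> Id_on S) = card (R \<union> R\<inverse>) + card (Id_on S)"
    using fin assms by (intro card_Un_disjoint) (auto simp: Id_on_def dest: asymD)
  moreover have "card (R \<union> R\<inverse>) = card R + card (R\<inverse>)"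
    using fin assms by (intro card_Un_disjoint) (auto dest: asymD)
  moreover have "card (Id_on S) = card S"
  proof -
    have "Id_on S = (\<lambda>x. (x, x)) ` S" by auto
    then show ?thesis by (simp add: card_image inj_on_def)
  qed
  moreover have "card (R \<union> R\<inverse> \<union> Id_on S) \<le> card (S \<times> S)"
    using assms by (intro card_mono) auto
  ultimately show ?thesis by (simp add: card_cartesian_product)
qed

section \<open>Flows in acyclic digraphs\<close>

context fin_digraph
begin

lemma net_outflow_altdef:
  "net_outflow G x v = (\<Sum>e\<in>arcs G. (of_bool (tail G e = v) - of_bool (head G e = v)) * x e)"
proof -
  have "(\<Sum>e\<in>out_arcs G v. x e) = (\<Sum>e\<in>arcs G. of_bool (tail G e = v) * x e)"
    unfolding out_arcs_def by (simp add: sum.inter_filter of_bool_def if_distrib[of "\<lambda>b. b * _"] cong: if_cong)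
  moreover have "(\<Sum>e\<in>in_arcs G v. x e) = (\<Sum>e\<in>arcs G. of_bool (head G e = v) * x e)"
    unfolding in_arcs_def by (simp add: sum.inter_filter of_bool_def if_distrib[of "\<lambda>b. b * _"] cong: if_cong)
  ultimately show ?thesis
    unfolding net_outflow_def by (simp add: left_diff_distrib sum_subtractf)
qed

lemma net_outflow_cong:
  "(\<And>e. e \<in> arcs G \<Longrightarrow> x e = y e) \<Longrightarrow> net_outflow G x v = net_outflow G y v"
  by (simp add: net_outflow_altdef)

lemma net_outflow_add_scaled:
  "net_outflow G (\<lambda>e. x e + c * y e) v = net_outflow G x v + c * net_outflow G y v"
  unfolding net_outflow_altdef sum_distrib_left sum.distrib[symmetric]
  by (rule sum.cong) (auto simp: algebra_simps)

lemma net_outflow_sum: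
  "net_outflow G (\<lambda>e. \<Sum>i\<in>I. y i e) v = (\<Sum>i\<in>I. net_outflow G (y i) v)"
  by (simp add: net_outflow_altdef sum_distrib_left sum.swap[of _ I])

text \<open>Every arc counts positively at its tail and negatively at its head. Hence conservation
  at all vertices but one forces it at the last one.\<close>

lemma sum_net_outflow: "(\<Sum>v\<in>verts G. net_outflow G x v) = 0"
proof -
  have "(\<Sum>v\<in>verts G. net_outflow G x v) =
      (\<Sum>e\<in>arcs G. (\<Sum>v\<in>verts G. of_bool (tail G e = v) - of_bool (head G e = v)) * x e)"
    by (simp add: net_outflow_altdef sum_distrib_right sum.swap[of _ "verts G"])
  also have "\<dots> = 0"
    by (intro sum.neutral) (simp add: sum_subtractf)
  finally show ?thesis .
qed

text \<open>The contributions of the arcs telescope along the walk; distinctness makes the indicator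
  count every occurrence.\<close>

lemma net_outflow_awalk:
  assumes "awalk u p v" "distinct p"
  shows "net_outflow G (\<lambda>e. of_bool (e \<in> set p)) w = of_bool (w = u) - of_bool (w = v)"
proof -
  have "net_outflow G (\<lambda>e. of_bool (e \<in> set p)) w =
      (\<Sum>e\<in>arcs G. if e \<in> set p then of_bool (tail G e = w) - of_bool (head G e = w) else 0)"
    unfolding net_outflow_altdef by (rule sum.cong) auto
  also have "\<dots> = (\<Sum>e\<in>set p. of_bool (tail G e = w) - of_bool (head G e = w))"
  proof -
    have "arcs G \<inter> set p = set p" using assms(1) by auto
    then show ?thesis by (simp add: sum.inter_restrict[symmetric])
  qed
  also have "\<dots> = (\<Sum>e\<leftarrow>p. of_bool (tail G e = w) - of_bool (head G e = w))"
    using assms(2) by (simp add: sum_list_distinct_conv_sum_set)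
  also have "\<dots> = of_bool (w = u) - of_bool (w = v)"
    using assms(1) by (induction p arbitrary: u) (auto simp: awalk_simps)
  finally show ?thesis .
qed

end

section \<open>Walks and path decomposition in acyclic digraphs\<close>

locale dag = fin_digraph +
  assumes no_cycle: "\<nexists>p. cycle p"

lemma acyclic_digraph_iff_dag: "acyclic_digraph G \<longleftrightarrow> dag G"
  by (simp add: acyclic_digraph_def dag_def dag_axioms_def)

context dag
begin

lemma closed_awalk_Nil: "awalk u p u \<Longrightarrow> p = []"
  using no_cycle closed_w_imp_cycle by (fastforce simp: closed_w_def)

text \<open>A walk with a repeated vertex contains a nonempty closed walk. Walks, which concatenate
  freely, can therefore stand in for paths below.\<close>

lemma awalk_apath: "awalk u p v \<Longrightarrow> apath u p v"
  using awalk_not_distinct_decomp[of u p v] closed_awalk_Nil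
  by (metis apath_def length_greater_0_conv)

lemma awalk_distinct: "awalk u p v \<Longrightarrow> distinct p"
  using awalk_apath distinct_verts_imp_distinct by (auto simp: apath_def)

text \<open>A longest walk inside \<open>F\<close> cannot be extended at either end; it exists
  because walks never repeat an arc. With \<open>F\<close> the support of a flow, its ends will turn
  out to be \<open>s\<close> and \<open>t\<close>.\<close>

lemma maximal_awalk:
  assumes "a \<in> F" "F \<subseteq> arcs G"
  obtains u p v where "awalk u p v" "p \<noteq> []" "set p \<subseteq> F"
    "\<And>e. e \<in> F \<Longrightarrow> tail G e \<noteq> v" "\<And>e. e \<in> F \<Longrightarrow> head G e \<noteq> u"
proof -
  define P where "P = (\<lambda>p. p \<noteq> [] \<and> set p \<subseteq> F \<and> (\<exists>u v. awalk u p v))"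
  have Pa: "P [a]" using assms by (auto simp: P_def intro: arc_implies_awalk)
  have bnd: "\<forall>p. P p \<longrightarrow> length p < Suc (card (arcs G))"
  proof (intro allI impI)
    fix p assume "P p"
    then have "distinct p" "set p \<subseteq> arcs G" using awalk_distinct assms(2) by (auto simp: P_def)
    then show "length p < Suc (card (arcs G))"
      using card_mono[of "arcs G" "set p"] by (simp add: distinct_card)
  qed
  obtain p where p: "P p" "\<And>q. P q \<Longrightarrow> length q \<le> length p"
    using ex_has_greatest_nat[of P, OF Pa bnd] by (elim exE conjE) simp
  then obtain u v where w: "awalk u p v" "p \<noteq> []" "set p \<subseteq> F" by (auto simp: P_def)
  have "tail G e \<noteq> v" if "e \<in> F" for e
  proof
    assume "tail G e = v"
    then have "awalk u (p @ [e]) (head G e)"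
      using w that assms(2) by (intro awalk_appendI) (auto simp: awalk_simps)
    with w that have "P (p @ [e])" by (auto simp del: awalk_append_iff simp: P_def)
    from p(2)[OF this] show False by simp
  qed
  moreover have "head G e \<noteq> u" if "e \<in> F" for e
  proof
    assume "head G e = u"
    then have "awalk (tail G e) (e # p) v" using w that assms(2) by (auto simp: awalk_simps)
    with w that have "P (e # p)" unfolding P_def by (metis insert_subset list.distinct(1) list.simps(15))
    from p(2)[OF this] show False by simp
  qed
  ultimately show ?thesis using that w by blast
qed

text \<open>Subtracting the bottleneck value along an \<open>s\<close>-\<open>t\<close>-path shrinks
  the support, so induction on its size applies; acyclicity rules out leftover circulations. The
  value \<open>c\<close> is arbitrary because it drops in each step.\<close>

theorem flow_decomposition:
  fixes x :: "'b \<Rightarrow> real"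
  assumes "s \<noteq> t" "s \<in> verts G"
    and "0 \<le> c"
    and "\<And>e. e \<in> arcs G \<Longrightarrow> 0 \<le> x e"
    and "\<And>v. v \<in> verts G \<Longrightarrow> net_outflow G x v = c * (of_bool (v = s) - of_bool (v = t))"
  shows "\<exists>y. (\<forall>p. 0 \<le> y p) \<and> sum y {p. apath s p t} = c \<and>
    (\<forall>e\<in>arcs G. x e = (\<Sum>p | apath s p t. y p * of_bool (e \<in> set p)))"
  using assms(3-5)
proof (induction "card {e \<in> arcs G. x e \<noteq> 0}" arbitrary: x c rule: less_induct)
  case less
  let ?F = "{e \<in> arcs G. x e \<noteq> 0}"
  show ?case
  proof (cases "?F = {}")
    case True
    then have "net_outflow G x s = 0" by (auto simp: net_outflow_altdef)
    then have "c = 0" using less.prems(3)[of s] assms(1,2) by simp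
    then show ?thesis using True by (intro exI[of _ "\<lambda>_. 0"]) auto
  next
    case False
    then obtain a where "a \<in> ?F" by blast
    obtain u p v where p: "awalk u p v" "p \<noteq> []" "set p \<subseteq> ?F"
      and out: "\<And>e. e \<in> ?F \<Longrightarrow> tail G e \<noteq> v" and inn: "\<And>e. e \<in> ?F \<Longrightarrow> head G e \<noteq> u"
      by (rule maximal_awalk[OF \<open>a \<in> ?F\<close> Collect_restrict]) simp
    have uv: "u \<in> verts G" "v \<in> verts G" "u \<noteq> v"
      using p(1,2) awalk_hd_in_verts awalk_last_in_verts closed_awalk_Nil by blast+
    \<comment> \<open>No arc of the support leaves \<open>v\<close>, yet the last arc of
      \<open>p\<close> enters it.\<close>
    have "net_outflow G x v < 0"
    proof -
      obtain q b where qb: "p = q @ [b]" using p(2) by (metis rev_exhaust)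
      then have b: "b \<in> ?F" "head G b = v" using p(1,3) by (auto simp: awalk_simps)
      have z: "sum x (out_arcs G v) = 0" using out by (intro sum.neutral ballI) fastforce
      have "x b \<le> sum x (in_arcs G v)"
        using b less.prems(2) by (intro member_le_sum) (auto simp: finite_in_arcs)
      then show ?thesis using z b(1) less.prems(2)[of b] by (simp add: net_outflow_def)
    qed
    \<comment> \<open>The first arc of the walk serves as \<open>b\<close>; the inequality later
      ensures that the bottleneck \<open>m\<close> is at most \<open>c\<close>.\<close>
    moreover obtain b where b: "b \<in> set p" "x b \<le> net_outflow G x u"
    proof -
      obtain q b where qb: "p = b # q" using p(2) by (cases p) auto
      then have b: "b \<in> ?F" "tail G b = u" using p(1,3) by (auto simp: awalk_simps)
      have z: "sum x (in_arcs G u) = 0" using inn by (intro sum.neutral ballI) fastforce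
      have "x b \<le> sum x (out_arcs G u)"
        using b less.prems(2) by (intro member_le_sum) (auto simp: finite_out_arcs)
      then show ?thesis using z qb by (intro that[of b]) (simp_all add: net_outflow_def)
    qed
    moreover have "x b > 0"
      using b(1) p(3) less.prems(2)[of b] by (auto simp: order.order_iff_strict)
    \<comment> \<open>Only \<open>s\<close> can have positive and only \<open>t\<close> negative net
      outflow.\<close>
    ultimately have st: "u = s" "v = t" and "x b \<le> c"
      using less.prems(3)[OF uv(1)] less.prems(3)[OF uv(2)] uv(3) less.prems(1)
      by (auto simp: of_bool_def split: if_splits)
    define m where "m = Min (x ` set p)"
    have m: "m \<in> x ` set p" "\<And>e. e \<in> set p \<Longrightarrow> m \<le> x e"
      using p(2) by (auto simp: m_def)
    have "0 < m" using m(1) p(3) less.prems(2) by (force simp: order.order_iff_strict)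
    define x' where "x' e = x e + (- m) * of_bool (e \<in> set p)" for e
    \<comment> \<open>A bottleneck arc drops out of the support, so the decrease is strict.\<close>
    have "{e \<in> arcs G. x' e \<noteq> 0} \<subset> ?F"
    proof (rule psubsetI)
      show "{e \<in> arcs G. x' e \<noteq> 0} \<subseteq> ?F" using p(3) by (auto simp: x'_def)
      obtain e where "e \<in> set p" "x e = m" using m(1) by auto
      then have "e \<in> ?F" "x' e = 0" using p(3) by (auto simp: x'_def)
      then show "{e \<in> arcs G. x' e \<noteq> 0} \<noteq> ?F" by blast
    qed
    then have "card {e \<in> arcs G. x' e \<noteq> 0} < card ?F" by (intro psubset_card_mono) auto
    moreover have "0 \<le> c - m" using m(2)[OF b(1)] \<open>x b \<le> c\<close> by simp
    moreover have "0 \<le> x' e" if "e \<in> arcs G" for e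
      using m(2) less.prems(2) that by (simp add: x'_def)
    moreover have "net_outflow G x' w = (c - m) * (of_bool (w = s) - of_bool (w = t))"
      if "w \<in> verts G" for w
      using less.prems(3)[OF that] p(1) awalk_distinct[OF p(1)] unfolding x'_def
      by (subst net_outflow_add_scaled) (simp add: net_outflow_awalk st algebra_simps)
    ultimately obtain y where y: "\<forall>p. 0 \<le> y p" "sum y {p. apath s p t} = c - m"
      "\<forall>e\<in>arcs G. x' e = (\<Sum>p | apath s p t. y p * of_bool (e \<in> set p))"
      using less.hyps[of x' "c - m"] by blast
    have mem: "p \<in> {p. apath s p t}" using p(1) st awalk_apath by simp
    have fin: "finite {p. apath s p t}" by (rule apaths_finite)
    define y' where "y' = y(p := y p + m)"
    have "sum y' {p. apath s p t} = c"
      using y(2) mem fin by (simp add: y'_def sum.remove[OF fin mem])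
    moreover have "x e = (\<Sum>p | apath s p t. y' p * of_bool (e \<in> set p))" if "e \<in> arcs G" for e
    proof -
      have "x e = (\<Sum>p | apath s p t. y p * of_bool (e \<in> set p)) + m * of_bool (e \<in> set p)"
        using y(3) that by (simp add: x'_def algebra_simps)
      also have "\<dots> = (\<Sum>p | apath s p t. y' p * of_bool (e \<in> set p))"
        by (simp add: y'_def sum.remove[OF fin mem] distrib_right)
      finally show ?thesis .
    qed
    moreover have "\<forall>q. 0 \<le> y' q" using y(1) \<open>0 < m\<close> by (simp add: y'_def add_nonneg_nonneg)
    ultimately show ?thesis by blast
  qed
qed

end

section \<open>Upper bound\<close>

context dag
begin

lemma incidence_vector_arc [simp]:
  "e \<in> arcs G \<Longrightarrow> incidence_vector (arcs G) P e = of_bool (e \<in> P)"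
  by (simp add: incidence_vector_def)

lemma path_vectors_eq_awalk:
  "path_vectors G s t = {incidence_vector (arcs G) (set p) | p. awalk s p t}"
  using awalk_apath awalkI_apath unfolding path_vectors_def by blast

lemma identifying_path_unique:
  assumes S: "identifying (arcs G) (path_vectors G s t) S"
    and "awalk s p t" "awalk s q t" "set p \<inter> S = set q \<inter> S"
  shows "set p = set q"
proof -
  let ?x = "\<lambda>p. incidence_vector (arcs G) (set p)"
  have "?x p \<in> path_vectors G s t" "?x q \<in> path_vectors G s t"
    using assms(2,3) by (auto simp: path_vectors_eq_awalk)
  moreover have "?x p e = ?x q e" if "e \<in> S" for e
    using assms(4) that by (auto simp: incidence_vector_def)
  ultimately have eq: "?x p = ?x q" using S unfolding identifying_def by blast
  have "e \<in> set p \<longleftrightarrow> e \<in> set q" if "e \<in> arcs G" for e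
    using fun_cong[OF eq, of e] that by (simp add: of_bool_eq_iff)
  then show ?thesis using assms(2,3) by (auto simp: awalk_def)
qed

text \<open>Extending both walks by the same prefix and suffix gives two
  \<open>s\<close>-\<open>t\<close>-paths with the same arcs in \<open>S\<close>, hence with the
  same arc set. Walks repeat no arc, so the common ends cancel.\<close>

lemma identifying_segment_unique:
  assumes S: "identifying (arcs G) (path_vectors G s t) S"
    and ab: "awalk s a u" "awalk v b t"
    and pq: "awalk u p v" "awalk u q v" "set p \<inter> S = {}" "set q \<inter> S = {}"
  shows "set p = set q"
proof -
  have w: "awalk s (a @ p @ b) t" "awalk s (a @ q @ b) t"
    using ab pq by (auto intro!: awalk_appendI simp del: awalk_append_iff)
  have "set (a @ p @ b) = set (a @ q @ b)"
    using pq(3,4) by (intro identifying_path_unique[OF S w]) auto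
  then show ?thesis
    using awalk_distinct[OF w(1)] awalk_distinct[OF w(2)] by auto
qed

text \<open>The index \<open>None\<close> stands for the source. Each vector \<open>w (i, j)\<close> swaps the \<open>S\<close>-free route from \<open>i\<close>
  to \<open>t\<close> for the one from \<open>i\<close> to \<open>j\<close> followed by the one from \<open>j\<close> to \<open>t\<close>, so the sum over the
  consecutive pairs on a path telescopes. A route that does not exist is a junk value, which cancels.\<close>

theorem path_vectors_affine_span:
  assumes S: "identifying (arcs G) (path_vectors G s t) S"
  obtains I :: "('b option \<times> 'b) set" and T :: "'b \<Rightarrow> real" and w :: "'b option \<times> 'b \<Rightarrow> 'b \<Rightarrow> real"
  where "finite I" "2 * card I \<le> (card S + 1) * card S"
    "\<forall>p. awalk s p t \<longrightarrow> (\<exists>z. \<forall>e. of_bool (e \<in> set p) = T e + (\<Sum>i\<in>I. z i * w i e))"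
proof -
  have SE: "S \<subseteq> arcs G" using S by (simp add: identifying_def)
  then have fS: "finite S" using finite_subset[OF _ finite_arcs] by blast
  \<comment> \<open>An index is the arc of \<open>S\<close> traversed last, or \<open>None\<close>
    before the first one; \<open>hd i\<close> is the vertex where the walk continues.\<close>
  define hd where "hd i = (case i of None \<Rightarrow> s | Some e \<Rightarrow> head G e)" for i
  \<comment> \<open>The choice is harmless: a route that avoids \<open>S\<close> and lies on an
    \<open>s\<close>-\<open>t\<close>-walk has its arc set determined by its ends.\<close>
  define seg where "seg u v = (SOME p. awalk u p v \<and> set p \<inter> S = {})" for u v
  define T where "T i e = (of_bool (e \<in> set (seg (hd i) t)) :: real)" for i e
  \<comment> \<open>\<open>C i j\<close> is the route from \<open>i\<close> up to and including the
    arc \<open>j\<close>.\<close>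
  define C where "C i j e = (of_bool (e \<in> set (seg (hd i) (tail G j))) + of_bool (e = j) :: real)" for i j e
  define w where "w = (\<lambda>(i, j) e. C i j e + T (Some j) e - T i e)"
  \<comment> \<open>Consecutive arcs of \<open>S\<close> on a walk are related by \<open>R\<close>;
    acyclicity makes it asymmetric, which halves the number of pairs.\<close>
  define R where "R = {(i, j) \<in> S \<times> S. \<exists>p. awalk (head G i) p (tail G j)}"
  define I where "I = (\<lambda>j. (None, j)) ` S \<union> (\<lambda>(i, j). (Some i, j)) ` R"
  have "asym R"
  proof (rule asymI)
    fix i j assume "(i, j) \<in> R"
    then obtain p where p: "awalk (head G i) p (tail G j)" "i \<in> S" "j \<in> S" by (auto simp: R_def)
    show "(j, i) \<notin> R"
    proof
      assume "(j, i) \<in> R"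
      then obtain q where "awalk (head G j) q (tail G i)" by (auto simp: R_def)
      then have "awalk (tail G i) ((i # p) @ (j # q)) (tail G i)"
        using p SE by (intro awalk_appendI[of _ _ "tail G j"]) (auto simp: awalk_Cons_iff)
      then show False using closed_awalk_Nil by blast
    qed
  qed
  then have cR: "2 * card R + card S \<le> card S * card S" and fR: "finite R"
    using fS by (auto simp: R_def intro!: card_asymmetric_relation intro: finite_subset[of _ "S \<times> S"])
  have fin: "finite I" using fS fR by (simp add: I_def)
  have "card I \<le> card S + card R"
    unfolding I_def using fS fR
    by (intro order.trans[OF card_Un_le] add_mono card_image_le)
  then have cI: "2 * card I \<le> (card S + 1) * card S" using cR by simp
  have seg: "set (seg u v) = set p"
    if "awalk s a u" "awalk v b t" "awalk u p v" "set p \<inter> S = {}" for a u p v b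
  proof -
    have "awalk u (seg u v) v \<and> set (seg u v) \<inter> S = {}"
      unfolding seg_def
      by (rule someI[of "\<lambda>p. awalk u p v \<and> set p \<inter> S = {}" p]) (simp add: that(3,4))
    then show ?thesis using identifying_segment_unique[OF S that(1,2)] that(3,4) by blast
  qed
  \<comment> \<open>Generalized to the remainder of a walk after index \<open>i\<close>; the prefix
    \<open>a\<close> places this remainder on an \<open>s\<close>-\<open>t\<close>-walk, as
    uniqueness of routes requires.\<close>
  have main: "\<exists>z. \<forall>e. of_bool (e \<in> set p) = T i e + (\<Sum>k\<in>I. z k * w k e)"
    if "awalk (hd i) p t" "awalk s a (hd i)" "i \<in> insert None (Some ` S)" for a p i
    using that
  proof (induction "length p" arbitrary: p i a rule: less_induct)
    case less
    show ?case
    proof (cases "set p \<inter> S = {}")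
      case True
      have "awalk t [] t" using less.prems(1) by (auto simp: awalk_Nil_iff)
      from seg[OF less.prems(2) this less.prems(1) True] show ?thesis
        by (intro exI[of _ "\<lambda>_. 0"]) (simp add: T_def)
    next
      case False
      then obtain q j r where p: "p = q @ j # r" and j: "j \<in> S" and q: "\<forall>e\<in>set q. e \<notin> S"
        using split_list_first_prop[of p "\<lambda>e. e \<in> S"] by blast
      then have aw: "awalk (hd i) q (tail G j)" "awalk (tail G j) (j # r) t" "awalk (head G j) r t"
        using less.prems(1) by (auto simp: awalk_Cons_iff)
      have "awalk s (a @ q @ [j]) (head G j)"
        using less.prems(2) aw j SE
        by (auto intro!: awalk_appendI simp: awalk_simps simp del: awalk_append_iff)
      then obtain z where z: "\<forall>e. of_bool (e \<in> set r) = T (Some j) e + (\<Sum>k\<in>I. z k * w k e)"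
        using less.hyps[of r "Some j" "a @ q @ [j]"] aw(3) j
        by (auto simp: p hd_def simp del: awalk_append_iff)
      have ij: "(i, j) \<in> I"
        using less.prems(3) j aw(1) by (auto simp: I_def R_def hd_def image_iff)
      have sq: "set (seg (hd i) (tail G j)) = set q"
        using q by (intro seg[OF less.prems(2) aw(2) aw(1)]) auto
      \<comment> \<open>The coefficient is incremented rather than set, since the induction
        hypothesis leaves its value at \<open>(i, j)\<close> open.\<close>
      have "of_bool (e \<in> set p) = T i e + (\<Sum>k\<in>I. (z((i, j) := z (i, j) + 1)) k * w k e)" for e
      proof -
        have "(of_bool (e \<in> set p) :: real) = of_bool (e \<in> set q) + of_bool (e = j) + of_bool (e \<in> set r)"
          using awalk_distinct[OF less.prems(1)] by (auto simp: p)
        also have "\<dots> = C i j e + of_bool (e \<in> set r)" by (simp add: C_def sq)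
        also have "\<dots> = T i e + w (i, j) e + (\<Sum>k\<in>I. z k * w k e)" using z by (simp add: w_def)
        also have "\<dots> = T i e + (\<Sum>k\<in>I. (z((i, j) := z (i, j) + 1)) k * w k e)"
          by (simp add: sum.remove[OF fin ij] algebra_simps)
        finally show ?thesis .
      qed
      then show ?thesis by blast
    qed
  qed
  show ?thesis
  proof (rule that[OF fin cI, of "T None" w], intro allI impI)
    fix p assume p: "awalk s p t"
    then have "awalk s [] s" by (auto simp: awalk_Nil_iff)
    then show "\<exists>z. \<forall>e. of_bool (e \<in> set p) = T None e + (\<Sum>i\<in>I. z i * w i e)"
      using main[of None p "[]"] p by (simp add: hd_def)
  qed
qed

text \<open>Unit flows are convex combinations of paths, so they lie in the affine space containing
  the path vectors. Their differences lie in the span of \<open>card I\<close> vectors, where at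
  most \<open>card I\<close> coordinates suffice to detect a nonzero vector.\<close>

theorem flow_identifying_set_from_path_identifying_set:
  assumes s: "s \<in> verts G" and S: "identifying (arcs G) (path_vectors G s t) S"
  shows "\<exists>S'. identifying (arcs G) (unit_flows G s t) S' \<and> 2 * card S' \<le> (card S + 1) * card S"
proof (cases "s = t")
  case True
  \<comment> \<open>The net outflow at \<open>s = t\<close> would have to be both \<open>1\<close>
    and \<open>-1\<close>.\<close>
  then have "unit_flows G s t = {}" by (auto simp: unit_flows_def)
  then show ?thesis by (intro exI[of _ "{}"]) (simp add: identifying_def)
next
  case False
  obtain I :: "('b option \<times> 'b) set" and T :: "'b \<Rightarrow> real" and w where I: "finite I" "2 * card I \<le> (card S + 1) * card S"
    and span: "\<forall>p. awalk s p t \<longrightarrow> (\<exists>z. \<forall>e. of_bool (e \<in> set p) = T e + (\<Sum>i\<in>I. z i * w i e))"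
    by (rule path_vectors_affine_span[OF S])
  then obtain z where z: "\<And>p e. awalk s p t \<Longrightarrow> of_bool (e \<in> set p) = T e + (\<Sum>i\<in>I. z p i * w i e)"
    by metis
  have flow: "\<exists>c. \<forall>e\<in>arcs G. x e = T e + (\<Sum>i\<in>I. c i * w i e)" if x: "x \<in> unit_flows G s t" for x
  proof -
    have "net_outflow G x v = 1 * (of_bool (v = s) - of_bool (v = t))" if "v \<in> verts G" for v
      using x that False by (auto simp: unit_flows_def)
    moreover have "0 \<le> x e" if "e \<in> arcs G" for e
      using x that by (auto simp: unit_flows_def)
    ultimately obtain y where y: "sum y {p. apath s p t} = 1"
      "\<forall>e\<in>arcs G. x e = (\<Sum>p | apath s p t. y p * of_bool (e \<in> set p))"
      using flow_decomposition[OF False s, of 1 x] by auto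
    have "x e = T e + (\<Sum>i\<in>I. (\<Sum>p | apath s p t. y p * z p i) * w i e)" if "e \<in> arcs G" for e
    proof -
      have "x e = (\<Sum>p | apath s p t. y p * (T e + (\<Sum>i\<in>I. z p i * w i e)))"
        using y(2) that z by (auto simp: awalkI_apath intro!: sum.cong)
      also have "\<dots> = sum y {p. apath s p t} * T e + (\<Sum>p | apath s p t. \<Sum>i\<in>I. y p * z p i * w i e)"
        by (simp add: distrib_left sum.distrib sum_distrib_right sum_distrib_left mult_ac)
      \<comment> \<open>The weights sum to one, so the offset \<open>T\<close> is kept.\<close>
      also have "\<dots> = T e + (\<Sum>i\<in>I. (\<Sum>p | apath s p t. y p * z p i) * w i e)"
        by (subst sum.swap) (simp add: y(1) sum_distrib_right)
      finally show ?thesis .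
    qed
    then show ?thesis by (intro exI[of _ "\<lambda>i. \<Sum>p | apath s p t. y p * z p i"] ballI)
  qed
  obtain S' where S': "S' \<subseteq> arcs G" "finite S'" "card S' \<le> card I"
    "\<And>z. \<forall>e\<in>S'. (\<Sum>i\<in>I. z i * w i e) = 0 \<Longrightarrow> \<forall>e\<in>arcs G. (\<Sum>i\<in>I. z i * w i e) = 0"
    using coordinates_separating_span[OF I(1), of "arcs G" w] by blast
  have "x = x'" if x: "x \<in> unit_flows G s t" and x': "x' \<in> unit_flows G s t"
    and eq: "\<forall>e\<in>S'. x e = x' e" for x x'
  proof -
    obtain c where c: "\<forall>e\<in>arcs G. x e = T e + (\<Sum>i\<in>I. c i * w i e)"
      using flow[OF x] by (elim exE)
    obtain c' where c': "\<forall>e\<in>arcs G. x' e = T e + (\<Sum>i\<in>I. c' i * w i e)"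
      using flow[OF x'] by (elim exE)
    have diff: "(\<Sum>i\<in>I. (c i - c' i) * w i e) = x e - x' e" if "e \<in> arcs G" for e
      using c c' that by (simp add: left_diff_distrib sum_subtractf)
    have "\<forall>e\<in>arcs G. (\<Sum>i\<in>I. (c i - c' i) * w i e) = 0"
      using eq diff S'(1) by (intro S'(4)) auto
    then have "\<forall>e\<in>arcs G. x e = x' e" using diff by simp
    moreover have "x \<in> extensional (arcs G)" "x' \<in> extensional (arcs G)"
      using x x' by (auto simp: unit_flows_def PiE_def)
    ultimately show ?thesis by (auto intro: extensionalityI)
  qed
  then have "identifying (arcs G) (unit_flows G s t) S'"
    using S'(1) unfolding identifying_def by blast
  moreover have "2 * card S' \<le> (card S + 1) * card S" using S'(3) I(2) by linarith
  ultimately show ?thesis by blast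
qed

end

section \<open>Tightness\<close>

context dag
begin

lemma restrict_unit_flow:
  assumes "s \<noteq> t" "s \<in> verts G" "t \<in> verts G"
    and "\<And>e. e \<in> arcs G \<Longrightarrow> 0 \<le> x e"
    and "\<And>v. v \<in> verts G \<Longrightarrow> net_outflow G x v = of_bool (v = s) - of_bool (v = t)"
  shows "restrict x (arcs G) \<in> unit_flows G s t"
proof -
  have "net_outflow G (restrict x (arcs G)) v = net_outflow G x v" for v
    by (rule net_outflow_cong) simp
  then show ?thesis using assms by (auto simp: unit_flows_def)
qed

text \<open>Choose an \<open>s\<close>-\<open>t\<close>-walk through each arc and average these
  walks over all arcs.\<close>

lemma positive_flow:
  assumes cover: "\<And>e. e \<in> arcs G \<Longrightarrow> \<exists>p. awalk s p t \<and> e \<in> set p"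
    and "arcs G \<noteq> {}"
  shows "\<exists>x. (\<forall>e\<in>arcs G. 0 < x e) \<and>
    (\<forall>v. net_outflow G x v = of_bool (v = s) - of_bool (v = t))"
proof -
  obtain q where q: "\<And>e. e \<in> arcs G \<Longrightarrow> awalk s (q e) t \<and> e \<in> set (q e)"
    using cover by metis
  define N where "N = (\<Sum>f\<in>arcs G. 1 :: real)"
  have N: "N > 0" using assms(2) by (simp add: N_def card_gt_0_iff)
  define x where "x e = (\<Sum>f\<in>arcs G. of_bool (e \<in> set (q f)) :: real)" for e
  have "0 < x e" if "e \<in> arcs G" for e
    unfolding x_def using that q by (intro sum_pos2[of _ e]) auto
  \<comment> \<open>The summand \<open>0\<close> brings the scaled flow into the form of
    \<open>net_outflow_add_scaled\<close>.\<close>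
  then have "0 < 0 + 1 / N * x e" if "e \<in> arcs G" for e using N that by simp
  moreover have "net_outflow G (\<lambda>e. 0 + 1 / N * x e) v = of_bool (v = s) - of_bool (v = t)" for v
  proof -
    have "net_outflow G x v = (\<Sum>f\<in>arcs G. of_bool (v = s) - of_bool (v = t))"
      unfolding x_def net_outflow_sum
      using q awalk_distinct by (intro sum.cong refl net_outflow_awalk) blast+
    also have "\<dots> = N * (of_bool (v = s) - of_bool (v = t))"
      by (simp add: N_def)
    finally show ?thesis
      unfolding net_outflow_add_scaled using N by (simp add: net_outflow_altdef)
  qed
  ultimately show ?thesis by (intro exI[of _ "\<lambda>e. 0 + 1 / N * x e"]) simp
qed

text \<open>A circulation vanishing on \<open>S\<close> solves
  \<open>card S + card (verts G) - 1\<close> linear equations, so with more arcs than that a nonzero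
  one exists. Adding a small multiple of it to an everywhere positive flow gives a second unit flow
  that agrees on \<open>S\<close>.\<close>

theorem card_flow_identifying_ge:
  assumes s: "s \<in> verts G"
    and cover: "\<And>e. e \<in> arcs G \<Longrightarrow> \<exists>p. awalk s p t \<and> e \<in> set p"
    and S: "identifying (arcs G) (unit_flows G s t) S"
  shows "card (arcs G) + 1 \<le> card S + card (verts G)"
proof (rule ccontr)
  assume "\<not> ?thesis"
  then have small: "card S + card (verts G) \<le> card (arcs G)" by simp
  have SE: "S \<subseteq> arcs G" using S by (simp add: identifying_def)
  then have fS: "finite S" using finite_subset[OF _ finite_arcs] by blast
  have pV: "0 < card (verts G)" using s by (auto simp: card_gt_0_iff)
  then have ne: "arcs G \<noteq> {}" using small by auto
  then obtain b p where "awalk s p t" "b \<in> set p" using cover by blast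
  then have st: "s \<noteq> t" "t \<in> verts G" using closed_awalk_Nil by (force, auto)
  \<comment> \<open>Conservation at \<open>s\<close> follows from the other vertices; leaving it out
    saves the one equation behind the \<open>+ 1\<close> in the bound.\<close>
  define C where "C = Inl ` S \<union> Inr ` (verts G - {s})"
  define a where "a c e = (case c of Inl f \<Rightarrow> of_bool (e = f)
      | Inr v \<Rightarrow> (of_bool (tail G e = v) - of_bool (head G e = v) :: real))" for c e
  have "card C = card S + card (verts G - {s})"
    unfolding C_def using fS by (subst card_Un_disjoint) (auto simp: card_image)
  then have "card C < card (arcs G)" using small pV s by simp
  moreover have "finite C" using fS by (simp add: C_def)
  ultimately obtain d where d: "\<exists>e\<in>arcs G. d e \<noteq> 0" "\<forall>c\<in>C. (\<Sum>e\<in>arcs G. a c e * d e) = 0"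
    using underdetermined_system_nontrivial_solution[of C "arcs G" a] by auto
  have dS: "d f = 0" if "f \<in> S" for f
  proof -
    have "(\<Sum>e\<in>arcs G. a (Inl f) e * d e) = d f"
      using that SE by (auto simp: a_def of_bool_def if_distrib[of "\<lambda>b. b * _"] cong: if_cong)
    then show ?thesis using d(2) that by (auto simp: C_def)
  qed
  have dv: "net_outflow G d v = 0" if "v \<in> verts G - {s}" for v
    using bspec[OF d(2), of "Inr v"] that by (simp add: C_def a_def net_outflow_altdef)
  moreover have "net_outflow G d s = 0"
    using sum_net_outflow[of d] dv by (simp add: sum.remove[OF _ s])
  ultimately have dv: "net_outflow G d v = 0" if "v \<in> verts G" for v using that by blast
  obtain x where x: "\<And>e. e \<in> arcs G \<Longrightarrow> 0 < x e"
    "\<And>v. net_outflow G x v = of_bool (v = s) - of_bool (v = t)"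
    using positive_flow[OF cover ne] by auto
  \<comment> \<open>Small enough to keep the perturbed flow nonnegative; \<open>1 +\<close> keeps
    the denominators positive where \<open>d e = 0\<close>.\<close>
  define \<epsilon> where "\<epsilon> = Min ((\<lambda>e. x e / (1 + \<bar>d e\<bar>)) ` arcs G)"
  have \<epsilon>: "0 < \<epsilon>" using x(1) ne by (auto simp: \<epsilon>_def intro!: divide_pos_pos)
  have bound: "0 \<le> x e + \<epsilon> * d e" if "e \<in> arcs G" for e
  proof -
    have "\<epsilon> \<le> x e / (1 + \<bar>d e\<bar>)" using that by (simp add: \<epsilon>_def)
    then have "\<epsilon> * (1 + \<bar>d e\<bar>) \<le> x e" by (simp add: pos_le_divide_eq)
    moreover have "- (\<epsilon> * d e) \<le> \<epsilon> * \<bar>d e\<bar>" using \<epsilon> by (simp add: minus_le_iff abs_le_iff flip: mult_minus_right)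
    ultimately show ?thesis using \<epsilon> by (simp add: algebra_simps)
  qed
  let ?x = "restrict x (arcs G)" and ?y = "restrict (\<lambda>e. x e + \<epsilon> * d e) (arcs G)"
  have "?x \<in> unit_flows G s t"
    using x st s by (intro restrict_unit_flow) (auto intro: less_imp_le)
  moreover have "?y \<in> unit_flows G s t"
    using x st s bound by (intro restrict_unit_flow) (auto simp: net_outflow_add_scaled dv)
  moreover have "?x e = ?y e" if "e \<in> S" for e
    using dS[OF that] by (simp add: restrict_def)
  ultimately have eq: "?x = ?y" using S unfolding identifying_def by blast
  obtain e where "e \<in> arcs G" "d e \<noteq> 0" using d(1) by blast
  then show False using fun_cong[OF eq, of e] \<epsilon> by simp
qed

end

text \<open>The acyclic tournament on \<open>0, \<dots>, k + 1\<close> with every inner vertex \<open>j\<close> split into an arc from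
  \<open>2 * j\<close> to \<open>2 * j + 1\<close>; the source is \<open>1\<close> and the sink is \<open>2 * k + 2\<close>.\<close>

definition split_arcs :: "nat \<Rightarrow> (nat \<times> nat) set" where
  "split_arcs k = (\<lambda>j. (2 * j, 2 * j + 1)) ` {1..k}"

text \<open>An arc runs from the exit of \<open>i\<close> to the entry of \<open>j\<close>; vertex
  \<open>0\<close> has only the exit \<open>1\<close>, and \<open>k + 1\<close> only the entry
  \<open>2 * k + 2\<close>. Listing \<open>j\<close> first makes the cardinality a sum of the
  \<open>j\<close>.\<close>

definition cross_arcs :: "nat \<Rightarrow> (nat \<times> nat) set" where
  "cross_arcs k = (\<lambda>(j, i). (2 * i + 1, 2 * j)) ` (SIGMA j:{1..k + 1}. {..<j})"

definition split_tournament :: "nat \<Rightarrow> (nat, nat \<times> nat) pre_digraph" where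
  "split_tournament k =
     \<lparr>verts = {1..2 * k + 2}, arcs = split_arcs k \<union> cross_arcs k, tail = fst, head = snd\<rparr>"

lemma split_tournament_simps [simp]:
  "verts (split_tournament k) = {1..2 * k + 2}"
  "arcs (split_tournament k) = split_arcs k \<union> cross_arcs k"
  "tail (split_tournament k) = fst"
  "head (split_tournament k) = snd"
  by (simp_all add: split_tournament_def)

lemma mem_split_arcs: "(a, b) \<in> split_arcs k \<longleftrightarrow> even a \<and> b = a + 1 \<and> 2 \<le> a \<and> a \<le> 2 * k"
  by (auto simp: split_arcs_def image_iff elim!: evenE)

lemma mem_cross_arcs: "(a, b) \<in> cross_arcs k \<longleftrightarrow> odd a \<and> even b \<and> a < b \<and> b \<le> 2 * k + 2"
  by (auto simp: cross_arcs_def image_iff elim!: evenE oddE) presburger+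

lemma finite_split_arcs: "finite (split_arcs k)" and card_split_arcs: "card (split_arcs k) = k"
  by (auto simp: split_arcs_def card_image inj_on_def)

lemma finite_cross_arcs: "finite (cross_arcs k)"
  by (simp add: cross_arcs_def)

lemma card_cross_arcs: "2 * card (cross_arcs k) = (k + 1) * (k + 2)"
proof -
  have "card (cross_arcs k) = (\<Sum>j = 1..k + 1. j)"
    unfolding cross_arcs_def by (subst card_image) (auto simp: inj_on_def)
  then show ?thesis using gauss_sum_from_Suc_0[of "k + 1", where ?'a = nat] by simp
qed

lemma card_arcs_split_tournament: "2 * card (arcs (split_tournament k)) = (k + 1) * (k + 2) + 2 * k"
proof -
  have "split_arcs k \<inter> cross_arcs k = {}" by (auto simp: mem_split_arcs mem_cross_arcs)
  then show ?thesis
    using card_cross_arcs[of k] by (simp add: card_Un_disjoint finite_split_arcs finite_cross_arcs card_split_arcs)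
qed

lemma digraph_split_tournament: "digraph (split_tournament k)"
proof
qed (auto simp: mem_split_arcs mem_cross_arcs finite_split_arcs finite_cross_arcs arc_to_ends_def
    Suc_le_eq odd_pos)

text \<open>Every arc increases the vertex number. This gives acyclicity and shows that a walk never
  returns to a vertex it has jumped over.\<close>

lemma awalk_split_tournament_le:
  assumes "pre_digraph.awalk (split_tournament k) u p v"
  shows "u \<le> v" "(a, b) \<in> set p \<Longrightarrow> u \<le> a" "p \<noteq> [] \<Longrightarrow> u < v"
proof -
  interpret digraph "split_tournament k" by (rule digraph_split_tournament)
  show "u \<le> v" "(a, b) \<in> set p \<Longrightarrow> u \<le> a" "p \<noteq> [] \<Longrightarrow> u < v"
    using assms
    by (induction p arbitrary: u) (force simp: awalk_simps mem_split_arcs mem_cross_arcs)+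
qed

lemma dag_split_tournament: "dag (split_tournament k)"
proof -
  interpret digraph "split_tournament k" by (rule digraph_split_tournament)
  show ?thesis
    by unfold_locales (auto simp: cycle_def dest!: awalk_split_tournament_le(3))
qed

text \<open>One cross arc leads from the source to any entry and from any exit to the sink; split
  arcs settle the remaining vertices.\<close>

lemma awalk_split_tournament_cover:
  assumes "e \<in> arcs (split_tournament k)"
  shows "\<exists>p. pre_digraph.awalk (split_tournament k) 1 p (2 * k + 2) \<and> e \<in> set p"
proof -
  interpret dag "split_tournament k" by (rule dag_split_tournament)
  have from1: "\<exists>p. awalk 1 p a" if "1 \<le> a" "a \<le> 2 * k + 2" for a
  proof (cases "even a")
    case True
    then have "awalk 1 [(1, a)] a" using that by (auto simp: awalk_simps mem_cross_arcs elim!: evenE)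
    then show ?thesis by blast
  next
    case False
    show ?thesis
    proof (cases "a = 1")
      case True
      then have "awalk 1 [] a" by (simp add: awalk_simps)
      then show ?thesis by blast
    next
      case nz: False
      then have "awalk 1 [(1, a - 1), (a - 1, a)] a"
        using that False by (auto simp: awalk_simps mem_cross_arcs mem_split_arcs elim!: oddE)
      then show ?thesis by blast
    qed
  qed
  have to_t: "\<exists>p. awalk b p (2 * k + 2)" if "1 \<le> b" "b \<le> 2 * k + 2" for b
  proof (cases "odd b")
    case True
    then have "b \<noteq> 2 * k + 2" by auto
    then have "awalk b [(b, 2 * k + 2)] (2 * k + 2)"
      using that True by (auto simp: awalk_simps mem_cross_arcs)
    then show ?thesis by blast
  next
    case False
    show ?thesis
    proof (cases "b = 2 * k + 2")
      case True
      then have "awalk b [] (2 * k + 2)" by (simp add: awalk_simps)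
      then show ?thesis by blast
    next
      case nz: False
      then have "b \<le> 2 * k" "2 \<le> b" using that False by presburger+
      then have "awalk b [(b, b + 1), (b + 1, 2 * k + 2)] (2 * k + 2)"
        using False by (auto simp: awalk_simps mem_cross_arcs mem_split_arcs)
      then show ?thesis by blast
    qed
  qed
  have v: "fst e \<in> {1..2 * k + 2}" "snd e \<in> {1..2 * k + 2}"
    using tail_in_verts[OF assms] head_in_verts[OF assms] by auto
  obtain p q where "awalk 1 p (fst e)" "awalk (snd e) q (2 * k + 2)"
    using from1[of "fst e"] to_t[of "snd e"] v by auto
  then have "awalk 1 (p @ e # q) (2 * k + 2)"
    using assms by (intro awalk_appendI) (auto simp: awalk_Cons_iff)
  then show ?thesis by (intro exI[of _ "p @ e # q"]) simp
qed

text \<open>Only the split arc leaves an entry. If the walks leave an exit for different entries,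
  the one at the smaller entry must next use its split arc, which the other walk has already jumped
  over.\<close>

lemma awalk_split_tournament_unique:
  assumes "pre_digraph.awalk (split_tournament k) u p (2 * k + 2)"
    and "pre_digraph.awalk (split_tournament k) u p' (2 * k + 2)"
    and "set p \<inter> split_arcs k = set p' \<inter> split_arcs k"
  shows "p = p'"
proof -
  interpret dag "split_tournament k" by (rule dag_split_tournament)
  have no_skip: False
    if w: "awalk b q (2 * k + 2)" "awalk b' q' (2 * k + 2)"
      and "even b" "b < b'" "2 \<le> b" "set q \<inter> split_arcs k \<subseteq> set q'" for b b' q q'
  proof -
    have "b < 2 * k + 2" using awalk_split_tournament_le(1)[OF w(2)] \<open>b < b'\<close> by simp
    then obtain c r where "q = c # r" using w(1) by (cases q) (auto simp: awalk_simps)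
    then have "c = (b, b + 1)" "c \<in> split_arcs k"
      using w(1) \<open>even b\<close> by (cases c; auto simp: awalk_simps mem_split_arcs mem_cross_arcs)+
    then have "(b, b + 1) \<in> set q'" using that(6) \<open>q = c # r\<close> by auto
    then show False using awalk_split_tournament_le(2)[OF w(2)] \<open>b < b'\<close> by fastforce
  qed
  show ?thesis
    using assms
  proof (induction p arbitrary: u p')
    case Nil
    then have "awalk u p' u" by (auto simp: awalk_simps)
    then have "p' = []" by (rule closed_awalk_Nil)
    then show ?case by simp
  next
    case (Cons c p)
    then have "p' \<noteq> []" using closed_awalk_Nil[of "2 * k + 2" "c # p"] by (auto simp: awalk_Nil_iff)
    then obtain c' q where p': "p' = c' # q" by (cases p') auto
    obtain b where c: "c = (u, b)" using Cons.prems(1) by (cases c) (auto simp: awalk_simps)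
    obtain b' where c': "c' = (u, b')" using Cons.prems(2) p' by (cases c') (auto simp: awalk_simps)
    have arc: "(u, b) \<in> split_arcs k \<union> cross_arcs k" "(u, b') \<in> split_arcs k \<union> cross_arcs k"
      and w: "awalk b p (2 * k + 2)" "awalk b' q (2 * k + 2)"
      using Cons.prems(1,2) by (auto simp: p' c c' awalk_simps)
    have notin: "c \<notin> set p" "c' \<notin> set q"
      using awalk_distinct[OF Cons.prems(1)] awalk_distinct[OF Cons.prems(2)] p' by auto
    have "b = b'"
    proof (cases "even u")
      case True
      then show ?thesis using arc by (auto simp: mem_split_arcs mem_cross_arcs)
    next
      case False
      then have cr: "even b" "even b'" "2 \<le> b" "2 \<le> b'" and "c \<notin> split_arcs k" "c' \<notin> split_arcs k"
        using arc by (auto simp: c c' mem_split_arcs mem_cross_arcs)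
      \<comment> \<open>Both first arcs are cross arcs, so dropping them leaves the traversed split
        arcs unchanged.\<close>
      then have "set p \<inter> split_arcs k = set q \<inter> split_arcs k"
        using Cons.prems(3) p' by auto
      then show ?thesis
        using no_skip[OF w] no_skip[OF w(2,1)] cr by (cases b b' rule: linorder_cases) auto
    qed
    \<comment> \<open>No walk repeats an arc, so dropping the common first arc removes it from both
      sides.\<close>
    moreover have "set p \<inter> split_arcs k = set q \<inter> split_arcs k"
      using Cons.prems(3) notin \<open>b = b'\<close> p' c c' by (auto simp: set_eq_iff)
    then have "p = q" using Cons.IH[OF w(1), of q] w(2) \<open>b = b'\<close> by simp
    ultimately show ?case using p' c c' by simp
  qed
qed

lemma identifying_split_arcs:
  "identifying (arcs (split_tournament k)) (path_vectors (split_tournament k) 1 (2 * k + 2)) (split_arcs k)"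
proof -
  interpret dag "split_tournament k" by (rule dag_split_tournament)
  have "p = q" if "awalk 1 p (2 * k + 2)" "awalk 1 q (2 * k + 2)"
    and eq: "\<forall>e\<in>split_arcs k. incidence_vector (arcs (split_tournament k)) (set p) e =
      incidence_vector (arcs (split_tournament k)) (set q) e" for p q
  proof (rule awalk_split_tournament_unique[OF that(1,2)])
    show "set p \<inter> split_arcs k = set q \<inter> split_arcs k"
      using eq by (fastforce simp: incidence_vector_def of_bool_def split: if_splits)
  qed
  then have "x = x'" if "x \<in> path_vectors (split_tournament k) 1 (2 * k + 2)"
    "x' \<in> path_vectors (split_tournament k) 1 (2 * k + 2)" "\<forall>e\<in>split_arcs k. x e = x' e" for x x'
    using that unfolding path_vectors_eq_awalk by blast
  then show ?thesis unfolding identifying_def by auto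
qed

text \<open>There are \<open>(k + 1) * (k + 2) / 2 + k\<close> arcs; subtracting the
  \<open>2 * k + 2\<close> vertices and adding one leaves \<open>k * (k + 1) / 2\<close>.\<close>

lemma card_flow_identifying_split_tournament:
  assumes "identifying (arcs (split_tournament k)) (unit_flows (split_tournament k) 1 (2 * k + 2)) S"
  shows "(k + 1) * k \<le> 2 * card S"
proof -
  interpret dag "split_tournament k" by (rule dag_split_tournament)
  have "card (arcs (split_tournament k)) + 1 \<le> card S + card (verts (split_tournament k))"
    using awalk_split_tournament_cover by (intro card_flow_identifying_ge[OF _ _ assms]) auto
  then show ?thesis using card_arcs_split_tournament[of k] by simp
qed

theorem theorem4p5:
  shows "(\<forall>(G :: ('a, 'b) pre_digraph) s t S S'.
            acyclic_digraph G \<longrightarrow> s \<in> verts G \<longrightarrow> t \<in> verts G \<longrightarrow>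
            min_identifying (arcs G) (path_vectors G s t) S \<longrightarrow>
            min_identifying (arcs G) (unit_flows G s t) S' \<longrightarrow>
            real (card S') \<le> (real (card S) + 1) * real (card S) / 2)
       \<and> (\<forall>k :: nat. \<exists>(G :: (nat, nat \<times> nat) pre_digraph) s t S S'.
            digraph G \<and> acyclic_digraph G \<and> s \<in> verts G \<and> t \<in> verts G \<and>
            min_identifying (arcs G) (path_vectors G s t) S \<and>
            min_identifying (arcs G) (unit_flows G s t) S' \<and>
            card S = k \<and>
            real (card S') = (real (card S) + 1) * real (card S) / 2)"
proof (intro conjI allI impI)
  fix G :: "('a, 'b) pre_digraph" and s t S S'
  assume "acyclic_digraph G" and s: "s \<in> verts G"
    and S: "min_identifying (arcs G) (path_vectors G s t) S"
    and S': "min_identifying (arcs G) (unit_flows G s t) S'"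
  then interpret dag G by (simp add: acyclic_digraph_iff_dag)
  obtain U where "identifying (arcs G) (unit_flows G s t) U" "2 * card U \<le> (card S + 1) * card S"
    using flow_identifying_set_from_path_identifying_set[OF s] S unfolding min_identifying_def by blast
  moreover from this have "card S' \<le> card U" using S' by (simp add: min_identifying_def)
  ultimately have "real (2 * card S') \<le> real ((card S + 1) * card S)"
    by (intro of_nat_mono) linarith
  then show "real (card S') \<le> (real (card S) + 1) * real (card S) / 2" by (simp add: algebra_simps)
next
  fix k :: nat
  let ?G = "split_tournament k" and ?t = "2 * k + 2"
  interpret dag ?G by (rule dag_split_tournament)
  have s: "1 \<in> verts ?G" by simp
  \<comment> \<open>The upper bound applied to the split arcs provides a set whose size meets the
    lower bound.\<close>
  obtain S' where S': "identifying (arcs ?G) (unit_flows ?G 1 ?t) S'" "2 * card S' \<le> (k + 1) * k"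
    using flow_identifying_set_from_path_identifying_set[OF s identifying_split_arcs]
    by (auto simp: card_split_arcs)
  have eq: "2 * card S' = (k + 1) * k"
    using S'(2) card_flow_identifying_split_tournament[OF S'(1)] by simp
  have flow: "min_identifying (arcs ?G) (unit_flows ?G 1 ?t) S'"
    using S'(1) card_flow_identifying_split_tournament eq by (fastforce simp: min_identifying_def)
  have path: "min_identifying (arcs ?G) (path_vectors ?G 1 ?t) (split_arcs k)"
    unfolding min_identifying_def
  proof (intro conjI allI impI identifying_split_arcs)
    fix T assume "identifying (arcs ?G) (path_vectors ?G 1 ?t) T"
    then obtain U where U: "identifying (arcs ?G) (unit_flows ?G 1 ?t) U" "2 * card U \<le> (card T + 1) * card T"
      using flow_identifying_set_from_path_identifying_set[OF s] by blast
    \<comment> \<open>A smaller \<open>T\<close> would yield, by the upper bound, a flow-identifying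
      set below the lower bound.\<close>
    have "k \<le> card T"
    proof (rule ccontr)
      assume "\<not> k \<le> card T"
      then have "(card T + 1) * card T < (k + 1) * k" by (intro mult_strict_mono) auto
      then show False using U card_flow_identifying_split_tournament[OF U(1)] by linarith
    qed
    then show "card (split_arcs k) \<le> card T" by (simp add: card_split_arcs)
  qed
  have "real (2 * card S') = real ((k + 1) * k)" by (simp only: eq)
  then have card: "real (card S') = (real (card (split_arcs k)) + 1) * real (card (split_arcs k)) / 2"
    by (simp add: card_split_arcs algebra_simps)
  show "\<exists>(G :: (nat, nat \<times> nat) pre_digraph) s t S S'.
            digraph G \<and> acyclic_digraph G \<and> s \<in> verts G \<and> t \<in> verts G \<and>
            min_identifying (arcs G) (path_vectors G s t) S \<and>
            min_identifying (arcs G) (unit_flows G s t) S' \<and>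
            card S = k \<and>
            real (card S') = (real (card S) + 1) * real (card S) / 2"
    by (rule exI[of _ ?G], rule exI[of _ 1], rule exI[of _ ?t], rule exI[of _ "split_arcs k"], rule exI[of _ S'])
      (intro conjI flow path card card_split_arcs digraph_split_tournament,
        auto simp: acyclic_digraph_iff_dag dag_split_tournament)
qed

end
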